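(* Let $A \in \mathbb{R}^{m \times n}$ have columns $a^1,\dots,a^n \in \mathbb{R}^m$, and let $K \subset \mathbb{R}^m$ be a closed, convex, and pointed cone. For all $\beta \in \mathbb{R}^m$, exactly one of the following holds: (i) $\mathbf{P}_+(\beta) \neq \emptyset$; (ii) $\mathbf{D}_+(\beta) \neq \emptyset$.
   Context: For $\beta^1,\beta^2\in\mathbb{R}^m$, $\beta^1 \preceq_K \beta^2$ means $\beta^2-\beta^1 \in K$. $\mathbb{Z}_+$ denotes the nonnegative integers. A function $F:\mathbb{R}^m\to\mathbb{R}$ is superadditive if $F(\beta^1)+F(\beta^2)\le F(\beta^1+\beta^2)$ for all $\beta^1,\beta^2\in\mathbb{R}^m$, and nondecreasing with respect to $K$ if $\beta^1\preceq_K\beta^2$ implies $F(\beta^1)\le F(\beta^2)$. $\Gamma^m$ is the set of all functions $F:\mathbb{R}^m\to\mathbb{R}$ that are superadditive and nondecreasing with respect to $K$. For $\beta\in\mathbb{R}^m$, $\mathbf{P}_+(\beta) = \{x : Ax \preceq_K \beta,\ x \in \mathbb{Z}^n_+\}$ and $\mathbf{D}_+(\beta) = \{F \in \Gamma^m : F(\beta)<0,\ F(a^j)\ge 0 \text{ for all } j=1,\dots,n\}$.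
   Formalization: The functions F in D_+(β) are additionally required to satisfy F(0)=0; without this both alternatives can hold, e.g. A=(1), K=[0,∞), β=0, F(u)=⌈u⌉−1. *)

theory Defs
  imports "HOL-Analysis.Analysis"
begin

(* The library predicate cone also holds of the empty set; pointedness, stated with
   equality rather than inclusion, supplies 0 \<in> K. *)
definition pointed :: "'a::real_vector set \<Rightarrow> bool" where
  "pointed K \<longleftrightarrow> K \<inter> uminus ` K = {0}"

definition cone_le :: "'a::real_vector set \<Rightarrow> 'a \<Rightarrow> 'a \<Rightarrow> bool" where
  "cone_le K b1 b2 \<longleftrightarrow> b2 - b1 \<in> K"

definition superadditive :: "('a::real_vector \<Rightarrow> real) \<Rightarrow> bool" where
  "superadditive F \<longleftrightarrow> (\<forall>b1 b2. F b1 + F b2 \<le> F (b1 + b2))"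

definition nondecreasing_wrt :: "'a::real_vector set \<Rightarrow> ('a \<Rightarrow> real) \<Rightarrow> bool" where
  "nondecreasing_wrt K F \<longleftrightarrow> (\<forall>b1 b2. cone_le K b1 b2 \<longrightarrow> F b1 \<le> F b2)"

definition Gamma_m :: "(real ^ 'm) set \<Rightarrow> (real ^ 'm \<Rightarrow> real) set" where
  "Gamma_m K = {F. superadditive F \<and> nondecreasing_wrt K F}"

definition P_plus :: "real ^ 'n ^ 'm \<Rightarrow> (real ^ 'm) set \<Rightarrow> real ^ 'm \<Rightarrow> (real ^ 'n) set" where
  "P_plus A K b = {x. cone_le K (A *v x) b \<and> (\<forall>j. x $ j \<in> \<nat>)}"

(* F 0 = 0 is the usual normalization in superadditive duality. It does not follow from
   superadditivity, which only gives F 0 \<le> 0, and without it the two alternatives are not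
   exclusive: for m = n = 1, A = (1), K the nonnegative half-line and b = 0, the point
   x = 0 is feasible, while F u = ceiling u - 1 is superadditive and nondecreasing with
   F 1 = 0 and F 0 = -1 < 0. *)
definition D_plus :: "real ^ 'n ^ 'm \<Rightarrow> (real ^ 'm) set \<Rightarrow> real ^ 'm \<Rightarrow> (real ^ 'm \<Rightarrow> real) set" where
  "D_plus A K b = {F \<in> Gamma_m K. F 0 = 0 \<and> F b < 0 \<and> (\<forall>j. F (column j A) \<ge> 0)}"

end

theory Submission
  imports Defs
begin

text \<open>The right-hand sides \<open>u\<close> for which the system is feasible form a monoid that contains the
  columns of \<open>A\<close> and is upward closed for \<open>K\<close>. The function that is \<open>0\<close> on this monoid and
  \<open>-1\<close> off it is superadditive: the only case that could fail, \<open>0 + 0 \<le> -1\<close>, is excluded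
  by closure under addition. It is therefore a certificate for every infeasible \<open>b\<close>.\<close>

lemma superadditive_sum:
  assumes "superadditive F" and "F 0 = 0"
  shows "(\<Sum>i\<in>I. F (f i)) \<le> F (\<Sum>i\<in>I. f i)"
proof (induction I rule: infinite_finite_induct)
  case (insert i I)
  have "F (f i) + F (\<Sum>i\<in>I. f i) \<le> F (f i + (\<Sum>i\<in>I. f i))"
    using assms(1) unfolding superadditive_def by blast
  with insert show ?case by simp
\<comment> \<open>Empty and infinite \<open>I\<close> remain: both sums are 0 there, so the claim
  reads \<open>0 \<le> F 0\<close>, which the normalization supplies.\<close>
qed (use assms(2) in auto)

lemma superadditive_scale_nat:
  assumes "superadditive F" and "F 0 = 0"
  shows "of_nat k * F v \<le> F (of_nat k *\<^sub>R v)"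
  using superadditive_sum[OF assms, of "\<lambda>_. v" "{..<k}"] by (simp add: sum_constant_scaleR)

text \<open>\<open>A *v x\<close> is a sum of columns repeated \<open>x $ j\<close> times.
  Integrality of \<open>x\<close> is essential: superadditivity controls repeated addition, not
  scaling by arbitrary nonnegative reals.\<close>

lemma superadditive_matrix_vector_nonneg:
  fixes A :: "real ^ 'n ^ 'm"
  assumes F: "superadditive F" "F 0 = 0"
    and col: "\<And>j. F (column j A) \<ge> 0" and x: "\<And>j. x $ j \<in> \<nat>"
  shows "F (A *v x) \<ge> 0"
proof -
  have nonneg: "F (x $ j *\<^sub>R column j A) \<ge> 0" for j
  proof -
    obtain k where "x $ j = of_nat k" using x[of j] by (auto elim: Nats_cases)
    then show ?thesis
      using order_trans[OF mult_nonneg_nonneg[OF of_nat_0_le_iff col] superadditive_scale_nat[OF F]]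
      by simp
  qed
  have "0 \<le> (\<Sum>j\<in>UNIV. F (x $ j *\<^sub>R column j A))"
    by (intro sum_nonneg nonneg)
  also have "\<dots> \<le> F (\<Sum>j\<in>UNIV. x $ j *\<^sub>R column j A)"
    by (rule superadditive_sum[OF F])
  finally show ?thesis
    by (simp add: matrix_mult_sum scalar_mult_eq_scaleR)
qed

lemma convex_cone_imp_add:
  assumes "convex K" "cone K" "x \<in> K" "y \<in> K"
  shows "x + y \<in> K"
  using convex_cone[of K] assms by simp

text \<open>Solutions add, and their slacks add within the convex cone \<open>K\<close>.\<close>

lemma P_plus_add:
  assumes "convex K" "cone K" "P_plus A K u \<noteq> {}" "P_plus A K v \<noteq> {}"
  shows "P_plus A K (u + v) \<noteq> {}"
proof -
  obtain x y where x: "u - A *v x \<in> K" "\<And>j. x $ j \<in> \<nat>" and y: "v - A *v y \<in> K" "\<And>j. y $ j \<in> \<nat>"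
    using assms(3,4) by (auto simp: P_plus_def cone_le_def)
  have "(u - A *v x) + (v - A *v y) \<in> K"
    by (intro convex_cone_imp_add assms(1,2) x(1) y(1))
  then have "x + y \<in> P_plus A K (u + v)"
    using x(2) y(2) by (simp add: P_plus_def cone_le_def algebra_simps)
  then show ?thesis by blast
qed

text \<open>The same \<open>x\<close> stays feasible: its slack grows by \<open>v - u\<close>, an
  element of \<open>K\<close>.\<close>

lemma P_plus_mono:
  assumes "convex K" "cone K" "cone_le K u v" "P_plus A K u \<noteq> {}"
  shows "P_plus A K v \<noteq> {}"
proof -
  obtain x where x: "u - A *v x \<in> K" "\<And>j. x $ j \<in> \<nat>"
    using assms(4) by (auto simp: P_plus_def cone_le_def)
  have "(u - A *v x) + (v - u) \<in> K"
    by (intro convex_cone_imp_add assms(1,2) x(1) assms(3)[unfolded cone_le_def])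
  then have "x \<in> P_plus A K v"
    using x(2) by (simp add: P_plus_def cone_le_def)
  then show ?thesis by blast
qed

lemma P_plus_zero: "0 \<in> K \<Longrightarrow> P_plus A K 0 \<noteq> {}"
proof -
  assume "0 \<in> K"
  then have "0 \<in> P_plus A K 0"
    by (simp add: P_plus_def cone_le_def)
  then show ?thesis by blast
qed

text \<open>The unit vector \<open>axis j 1\<close> solves the system with slack 0.\<close>

lemma P_plus_column:
  fixes A :: "real ^ 'n ^ 'm"
  shows "0 \<in> K \<Longrightarrow> P_plus A K (column j A) \<noteq> {}"
proof -
  assume "0 \<in> K"
  moreover have "(axis j 1 :: real ^ 'n) $ i \<in> \<nat>" for i
    by (simp add: axis_def)
  ultimately have "axis j 1 \<in> P_plus A K (column j A)"
    by (simp add: P_plus_def cone_le_def matrix_vector_mult_basis)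
  then show ?thesis by blast
qed

lemma infeasibility_certificate:
  fixes A :: "real ^ 'n ^ 'm"
  assumes "convex K" "cone K" "0 \<in> K" and b: "P_plus A K b = {}"
  shows "(\<lambda>u. if P_plus A K u \<noteq> {} then 0 else - 1) \<in> D_plus A K b"
proof -
  let ?F = "\<lambda>u. if P_plus A K u \<noteq> {} then 0 else - 1 :: real"
  have "superadditive ?F"
    unfolding superadditive_def
  proof (intro allI)
    fix u v
    show "?F u + ?F v \<le> ?F (u + v)"
      using P_plus_add[OF assms(1,2), of A u v] by simp
  qed
  moreover have "nondecreasing_wrt K ?F"
    unfolding nondecreasing_wrt_def
  proof (intro allI impI)
    fix u v assume "cone_le K u v"
    then show "?F u \<le> ?F v"
      \<comment> \<open>Only a drop from 0 to -1 could violate monotonicity; upward closure of the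
        feasible right-hand sides rules it out.\<close>
      using P_plus_mono[OF assms(1,2), of u v A] by simp
  qed
  ultimately show ?thesis
    using P_plus_zero[OF assms(3), of A] P_plus_column[OF assms(3), of A] b
    by (simp add: D_plus_def Gamma_m_def)
qed

text \<open>Weak duality: a feasible \<open>x\<close> and a certificate \<open>F\<close> would give
  \<open>0 \<le> F (A *v x) \<le> F b < 0\<close>.\<close>

lemma P_plus_D_plus_exclusive:
  assumes "x \<in> P_plus A K b" "F \<in> D_plus A K b"
  shows False
proof -
  have "F (A *v x) \<ge> 0"
    using assms superadditive_matrix_vector_nonneg[of F A x]
    by (simp add: P_plus_def D_plus_def Gamma_m_def)
  moreover have "F (A *v x) \<le> F b"
    using assms by (simp add: P_plus_def D_plus_def Gamma_m_def nondecreasing_wrt_def)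
  ultimately show False
    using assms(2) by (simp add: D_plus_def)
qed

theorem proposition5:
  fixes A :: "real ^ 'n ^ 'm" and K :: "(real ^ 'm) set"
  assumes "closed K" and "convex K" and "cone K" and "pointed K"
  shows "\<forall>b :: real ^ 'm.
    (P_plus A K b \<noteq> {} \<or> D_plus A K b \<noteq> {}) \<and>
    \<not> (P_plus A K b \<noteq> {} \<and> D_plus A K b \<noteq> {})"
proof -
  \<comment> \<open>Membership of 0 makes the zero vector and the columns feasible right-hand sides,
    so the certificate takes the value 0 there.\<close>
  have "0 \<in> K" using assms(4) by (auto simp: pointed_def)
  then have "P_plus A K b \<noteq> {} \<or> D_plus A K b \<noteq> {}" for b
    using infeasibility_certificate[OF assms(2,3), of A b] by blast
  moreover have "\<not> (P_plus A K b \<noteq> {} \<and> D_plus A K b \<noteq> {})" for b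
    using P_plus_D_plus_exclusive[of _ A K b] by blast
  ultimately show ?thesis by simp
qed

end
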